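(* A meta-Wajsberg algebra is a Wajsberg algebra if and only if its relation $\le$ is antisymmetric.
   Context: A BE algebra is an algebra $(X,\to,1)$ of type $(2,0)$ such that for all $x,y,z\in X$: $x\to x=1$; $x\to 1=1$; $1\to x=x$; $x\to (y\to z)=y\to (x\to z)$. Write $x\le y$ iff $x\to y=1$. It is bounded if there is $0\in X$ with $0\le x$ for all $x\in X$; then $x^*:=x\to 0$. It is involutive if it is bounded and $x^{**}=x$ for all $x\in X$; an involutive BE algebra is denoted $(X,\to,^*,1)$. In an involutive BE algebra define $x\Cap y=((x^*\to y^* )\to y^* )^*$. A meta-Wajsberg algebra is an involutive BE algebra satisfying $(x\Cap y)\to (y\Cap x)=1$ for all $x,y$. A Wajsberg algebra is an algebra $(X,\to,^*,1)$ of type $(2,1,0)$ such that for all $x,y,z\in X$: $1\to x=x$; $(y\to z)\to ((z\to x)\to (y\to x))=1$; $(x\to y)\to y=(y\to x)\to x$; $(x^*\to y^* )\to (y\to x)=1$. *)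

theory Defs
  imports Main
begin

locale BE_algebra =
  fixes X :: "'a set"
    and imp :: "'a \<Rightarrow> 'a \<Rightarrow> 'a" (infixr "\<rightarrow>" 65)
    and one :: 'a ("\<one>")
  assumes imp_closed: "\<lbrakk>x \<in> X; y \<in> X\<rbrakk> \<Longrightarrow> x \<rightarrow> y \<in> X"
    and one_closed: "\<one> \<in> X"
    and imp_self: "x \<in> X \<Longrightarrow> x \<rightarrow> x = \<one>"
    and imp_one: "x \<in> X \<Longrightarrow> x \<rightarrow> \<one> = \<one>"
    and one_imp: "x \<in> X \<Longrightarrow> \<one> \<rightarrow> x = x"
    and imp_exchange:
      "\<lbrakk>x \<in> X; y \<in> X; z \<in> X\<rbrakk> \<Longrightarrow> x \<rightarrow> (y \<rightarrow> z) = y \<rightarrow> (x \<rightarrow> z)"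
begin

definition le :: "'a \<Rightarrow> 'a \<Rightarrow> bool" (infix "\<preceq>" 50)
  where "x \<preceq> y \<longleftrightarrow> x \<rightarrow> y = \<one>"

end

text \<open>
  Without antisymmetry a BE algebra may have several elements below all others, and the
  complement depends on which of them is taken as bound. The unary operation is therefore part
  of the structure, required to be \<open>x \<rightarrow> zero\<close> for some bound \<open>zero\<close>; this bound is determined by
  the operation, as \<open>star \<one> = \<one> \<rightarrow> zero = zero\<close>.
\<close>

locale involutive_BE_algebra = BE_algebra X imp one
  for X :: "'a set"
    and imp :: "'a \<Rightarrow> 'a \<Rightarrow> 'a" (infixr "\<rightarrow>" 65)
    and star :: "'a \<Rightarrow> 'a"
    and one :: 'a ("\<one>") +
  assumes bounded_star:
      "\<exists>zero\<in>X. (\<forall>x\<in>X. zero \<preceq> x) \<and> (\<forall>x\<in>X. star x = x \<rightarrow> zero)"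
    and star_star: "x \<in> X \<Longrightarrow> star (star x) = x"
begin

definition Cap :: "'a \<Rightarrow> 'a \<Rightarrow> 'a" (infixl "\<Cap>" 70)
  where "x \<Cap> y = star ((star x \<rightarrow> star y) \<rightarrow> star y)"

end

locale meta_Wajsberg_algebra = involutive_BE_algebra X imp star one
  for X :: "'a set"
    and imp :: "'a \<Rightarrow> 'a \<Rightarrow> 'a" (infixr "\<rightarrow>" 65)
    and star :: "'a \<Rightarrow> 'a"
    and one :: 'a ("\<one>") +
  assumes Cap_imp_Cap: "\<lbrakk>x \<in> X; y \<in> X\<rbrakk> \<Longrightarrow> (x \<Cap> y) \<rightarrow> (y \<Cap> x) = \<one>"

locale Wajsberg_algebra =
  fixes X :: "'a set"
    and imp :: "'a \<Rightarrow> 'a \<Rightarrow> 'a" (infixr "\<rightarrow>" 65)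
    and star :: "'a \<Rightarrow> 'a"
    and one :: 'a ("\<one>")
  assumes imp_closed: "\<lbrakk>x \<in> X; y \<in> X\<rbrakk> \<Longrightarrow> x \<rightarrow> y \<in> X"
    and star_closed: "x \<in> X \<Longrightarrow> star x \<in> X"
    and one_closed: "\<one> \<in> X"
    and one_imp: "x \<in> X \<Longrightarrow> \<one> \<rightarrow> x = x"
    and imp_trans:
      "\<lbrakk>x \<in> X; y \<in> X; z \<in> X\<rbrakk> \<Longrightarrow> (y \<rightarrow> z) \<rightarrow> ((z \<rightarrow> x) \<rightarrow> (y \<rightarrow> x)) = \<one>"
    and imp_commute:
      "\<lbrakk>x \<in> X; y \<in> X\<rbrakk> \<Longrightarrow> (x \<rightarrow> y) \<rightarrow> y = (y \<rightarrow> x) \<rightarrow> x"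
    and contrapos:
      "\<lbrakk>x \<in> X; y \<in> X\<rbrakk> \<Longrightarrow> (star x \<rightarrow> star y) \<rightarrow> (y \<rightarrow> x) = \<one>"

end

theory Submission
  imports Defs
begin

text \<open>The link is the commutative law \<open>(x \<rightarrow> y) \<rightarrow> y = (y
  \<rightarrow> x) \<rightarrow> x\<close>. Up to stars this is commutativity of
  \<open>\<Cap>\<close> (\<open>star_Cap_star\<close>), and the meta-Wajsberg axiom is exactly that
  commutativity up to mutual \<open>\<preceq>\<close>; antisymmetry turns it into an equation. The
  other Wajsberg axioms then follow from exchange and involution
  (\<open>imp_trans_if_commutative\<close>, \<open>star_imp_star\<close>). Conversely, the
  commutative law alone forces antisymmetry (\<open>imp_antisym\<close>).\<close>

context BE_algebra
begin

text \<open>Exchange, commutativity and exchange again turn the inner implication into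
  \<open>(x \<rightarrow> z) \<rightarrow> (y \<rightarrow> z)\<close>; a last exchange brings the
  two copies of \<open>y \<rightarrow> z\<close> together.\<close>

lemma imp_trans_if_commutative:
  assumes comm: "\<And>x y. \<lbrakk>x \<in> X; y \<in> X\<rbrakk> \<Longrightarrow> (x \<rightarrow> y) \<rightarrow> y = (y \<rightarrow> x) \<rightarrow> x"
    and X: "x \<in> X" "y \<in> X" "z \<in> X"
  shows "(y \<rightarrow> z) \<rightarrow> ((z \<rightarrow> x) \<rightarrow> (y \<rightarrow> x)) = \<one>"
proof -
  have "(z \<rightarrow> x) \<rightarrow> (y \<rightarrow> x) = y \<rightarrow> ((z \<rightarrow> x) \<rightarrow> x)"
    using X by (intro imp_exchange imp_closed)
  also have "\<dots> = y \<rightarrow> ((x \<rightarrow> z) \<rightarrow> z)"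
    using X by (simp only: comm)
  also have "\<dots> = (x \<rightarrow> z) \<rightarrow> (y \<rightarrow> z)"
    using X by (intro imp_exchange imp_closed)
  finally have "(y \<rightarrow> z) \<rightarrow> ((z \<rightarrow> x) \<rightarrow> (y \<rightarrow> x)) = (y \<rightarrow> z) \<rightarrow> ((x \<rightarrow> z) \<rightarrow> (y \<rightarrow> z))"
    by simp
  also have "\<dots> = (x \<rightarrow> z) \<rightarrow> ((y \<rightarrow> z) \<rightarrow> (y \<rightarrow> z))"
    using X by (intro imp_exchange imp_closed)
  also have "\<dots> = \<one>"
    using X by (simp add: imp_self imp_one imp_closed)
  finally show ?thesis .
qed

end

context involutive_BE_algebra
begin

lemma star_closed: "x \<in> X \<Longrightarrow> star x \<in> X"
  using bounded_star imp_closed by metis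

text \<open>Exchange pulls \<open>y\<close> to the front, leaving
  \<open>star x \<rightarrow> zero\<close>, the double complement of \<open>x\<close>. The Wajsberg
  contraposition axiom thus becomes an instance of \<open>imp_self\<close>.\<close>

lemma star_imp_star:
  assumes "x \<in> X" "y \<in> X"
  shows "star x \<rightarrow> star y = y \<rightarrow> x"
proof -
  obtain zero where zero: "zero \<in> X" "\<And>x. x \<in> X \<Longrightarrow> star x = x \<rightarrow> zero"
    using bounded_star by blast
  have "star x \<rightarrow> star y = star x \<rightarrow> (y \<rightarrow> zero)"
    using assms zero by simp
  also have "\<dots> = y \<rightarrow> (star x \<rightarrow> zero)"
    using assms zero by (intro imp_exchange star_closed)
  also have "star x \<rightarrow> zero = x"
    using assms zero(2)[of "star x"] by (simp add: star_closed star_star)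
  finally show ?thesis .
qed

lemma Cap_closed: "\<lbrakk>x \<in> X; y \<in> X\<rbrakk> \<Longrightarrow> x \<Cap> y \<in> X"
  by (simp add: Cap_def star_closed imp_closed)

text \<open>\<open>\<Cap>\<close> is the De Morgan dual of the join-like term
  \<open>(x \<rightarrow> y) \<rightarrow> y\<close>.\<close>

lemma star_Cap_star:
  "\<lbrakk>x \<in> X; y \<in> X\<rbrakk> \<Longrightarrow> star (star x \<Cap> star y) = (x \<rightarrow> y) \<rightarrow> y"
  by (simp add: Cap_def star_star star_closed imp_closed)

end

context meta_Wajsberg_algebra
begin

lemma Wajsberg_algebra_if_antisymp_on:
  assumes anti: "antisymp_on X (\<preceq>)"
  shows "Wajsberg_algebra X imp star one"
proof -
  have Cap_commute: "x \<Cap> y = y \<Cap> x" if "x \<in> X" "y \<in> X" for x y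
    \<comment> \<open>The axiom \<open>Cap_imp_Cap\<close>, read with both orders of its arguments,
      gives the two inequalities.\<close>
    using anti that by (auto intro!: antisymp_onD[of X] Cap_closed simp: le_def Cap_imp_Cap)
  have comm: "(x \<rightarrow> y) \<rightarrow> y = (y \<rightarrow> x) \<rightarrow> x" if "x \<in> X" "y \<in> X" for x y
    using that Cap_commute[of "star x" "star y"] star_Cap_star[of x y] star_Cap_star[of y x]
    by (simp add: star_closed)
  show ?thesis
  proof
    show "(star x \<rightarrow> star y) \<rightarrow> (y \<rightarrow> x) = \<one>" if "x \<in> X" "y \<in> X" for x y
      using that by (simp add: star_imp_star imp_self imp_closed)
  qed (use comm imp_trans_if_commutative in
      \<open>simp_all add: imp_closed star_closed one_closed one_imp\<close>)
qed

end

text \<open>Under these hypotheses the commutative law collapses to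
  \<open>\<one> \<rightarrow> y = \<one> \<rightarrow> x\<close>.\<close>

lemma (in Wajsberg_algebra) imp_antisym:
  assumes "x \<in> X" "y \<in> X" "x \<rightarrow> y = \<one>" "y \<rightarrow> x = \<one>"
  shows "x = y"
  using imp_commute[of x y] assms by (simp add: one_imp)

theorem proposition4p8:
  fixes X :: "'a set"
    and imp :: "'a \<Rightarrow> 'a \<Rightarrow> 'a"
    and star :: "'a \<Rightarrow> 'a"
    and one :: 'a
  assumes "meta_Wajsberg_algebra X imp star one"
  shows "Wajsberg_algebra X imp star one \<longleftrightarrow> antisymp_on X (BE_algebra.le imp one)"
proof -
  interpret meta_Wajsberg_algebra X imp star one by fact
  show ?thesis
    using Wajsberg_algebra_if_antisymp_on Wajsberg_algebra.imp_antisym[of X imp star one]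
    by (auto intro!: antisymp_onI simp: le_def)
qed

end
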